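(* For every integer $n\ge 3$ we have $c_{\mathcal S}(n)\le \dfrac{n}{3}$.
   Context: Let $N=\{1,\dots,n\}$. A simple game on $n$ voters is a function $\chi:2^N\to\{0,1\}$ with $\chi(\emptyset)=0$, $\chi(N)=1$ and $\chi(S)\le\chi(T)$ whenever $S\subseteq T\subseteq N$; $\mathcal S_n$ is the set of all of them. A coalition $S\subseteq N$ is winning if $\chi(S)=1$ and losing if $\chi(S)=0$. For real weights $w_1,\dots,w_n$ write $w(S)=\sum_{i\in S}w_i$. For real $\alpha\ge 1$, $\chi$ is $\alpha$-roughly weighted if there are $w_1,\dots,w_n\in\mathbb R$ with $w(S)\ge 1$ for all winning $S$ and $w(S)\le\alpha$ for all losing $S$. The critical threshold value $\mu(\chi)$ is the smallest $\alpha\ge 1$ such that $\chi$ is $\alpha$-roughly weighted. Finally $c_{\mathcal S}(n)=\max\{\mu(\chi)\mid\chi\in\mathcal S_n\}$. *)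

theory Defs
  imports "HOL-Analysis.Analysis"
begin

text \<open>The voters are \<open>{1..n}\<close>. A game is an extensional function on \<open>Pow {1..n}\<close>
  (\<open>undefined\<close> outside), so that two games are equal iff they agree on all coalitions
  and there are only finitely many of them.\<close>

definition simple_games :: "nat \<Rightarrow> (nat set \<Rightarrow> nat) set" where
  "simple_games n = {g \<in> Pow {1..n} \<rightarrow>\<^sub>E {0, 1}.
     g {} = 0 \<and> g {1..n} = 1 \<and>
     (\<forall>S T. S \<subseteq> T \<and> T \<subseteq> {1..n} \<longrightarrow> g S \<le> g T)}"

definition winning :: "nat \<Rightarrow> (nat set \<Rightarrow> nat) \<Rightarrow> nat set \<Rightarrow> bool" where
  "winning n g S \<longleftrightarrow> S \<subseteq> {1..n} \<and> g S = 1"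

definition losing :: "nat \<Rightarrow> (nat set \<Rightarrow> nat) \<Rightarrow> nat set \<Rightarrow> bool" where
  "losing n g S \<longleftrightarrow> S \<subseteq> {1..n} \<and> g S = 0"

definition weight :: "(nat \<Rightarrow> real) \<Rightarrow> nat set \<Rightarrow> real" where
  "weight w S = (\<Sum>i\<in>S. w i)"

definition roughly_weighted :: "nat \<Rightarrow> real \<Rightarrow> (nat set \<Rightarrow> nat) \<Rightarrow> bool" where
  "roughly_weighted n \<alpha> g \<longleftrightarrow>
     (\<exists>w :: nat \<Rightarrow> real.
        (\<forall>S. winning n g S \<longrightarrow> weight w S \<ge> 1) \<and>
        (\<forall>S. losing n g S \<longrightarrow> weight w S \<le> \<alpha>))"

text \<open>The minimum is attained for every simple game with at least one voter, see
  \<open>critical_threshold_attained\<close> below.\<close>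

definition critical_threshold :: "nat \<Rightarrow> (nat set \<Rightarrow> nat) \<Rightarrow> real" where
  "critical_threshold n g = (LEAST \<alpha>. 1 \<le> \<alpha> \<and> roughly_weighted n \<alpha> g)"

definition c_S :: "nat \<Rightarrow> real" where
  "c_S n = Max (critical_threshold n ` simple_games n)"

text \<open>\<open>LEAST\<close> and \<open>Max\<close> are unspecified when there is no least, respectively greatest,
  element. The following lemmas show that this does not occur for \<open>n \<ge> 1\<close>.\<close>

lemma finite_simple_games: "finite (simple_games n)"
proof -
  have "finite (Pow {1..n} \<rightarrow>\<^sub>E {0, 1::nat})"
    by (intro finite_PiE) auto
  thus ?thesis unfolding simple_games_def by (rule rev_finite_subset) auto
qed

lemma simple_games_nonempty:
  assumes "n \<ge> 1"
  shows "simple_games n \<noteq> {}"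
proof -
  define g :: "nat set \<Rightarrow> nat"
    where "g = (\<lambda>S\<in>Pow {1..n}. if S = {} then 0 else 1)"
  have "g \<in> simple_games n"
    unfolding simple_games_def g_def using assms by (auto simp: PiE_def)
  thus ?thesis by blast
qed

text \<open>Truncating arbitrary weights to \<open>[0,1]\<close> preserves both families of inequalities.\<close>

lemma truncate_weights:
  assumes g: "g \<in> simple_games n"
    and win: "\<And>S. winning n g S \<Longrightarrow> weight w S \<ge> 1"
    and lose: "\<And>S. losing n g S \<Longrightarrow> weight w S \<le> \<alpha>"
  defines "v \<equiv> \<lambda>i. min 1 (max 0 (w i))"
  shows "\<And>S. winning n g S \<Longrightarrow> weight v S \<ge> 1"
    and "\<And>S. losing n g S \<Longrightarrow> weight v S \<le> \<alpha>"
proof -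
  fix S assume S: "winning n g S"
  hence fin: "finite S" by (auto simp: winning_def intro: finite_subset)
  show "weight v S \<ge> 1"
  proof (cases "\<exists>i\<in>S. w i \<ge> 1")
    case True
    then obtain i where i: "i \<in> S" "w i \<ge> 1" by blast
    have "v i \<le> weight v S"
      unfolding weight_def by (rule member_le_sum) (use i fin in \<open>auto simp: v_def\<close>)
    moreover have "v i = 1" using i by (simp add: v_def)
    ultimately show ?thesis by simp
  next
    case False
    have "weight w S \<le> weight v S"
      unfolding weight_def by (rule sum_mono) (use False in \<open>force simp: v_def\<close>)
    with win[OF S] show ?thesis by simp
  qed
next
  fix S assume S: "losing n g S"
  hence fin: "finite S" by (auto simp: losing_def intro: finite_subset)
  define P where "P = {i\<in>S. w i > 0}"
  have sub: "P \<subseteq> S" "S \<subseteq> {1..n}" "g S = 0" using S by (auto simp: P_def losing_def)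
  have "g P \<le> g S" using g sub unfolding simple_games_def by blast
  hence P: "losing n g P" using sub by (auto simp: losing_def)
  have "weight v S = weight v P"
    unfolding weight_def
    by (rule sum.mono_neutral_right) (use fin in \<open>auto simp: P_def v_def\<close>)
  also have "\<dots> \<le> weight w P"
    unfolding weight_def by (rule sum_mono) (auto simp: v_def P_def)
  also have "\<dots> \<le> \<alpha>" by (rule lose[OF P])
  finally show "weight v S \<le> \<alpha>" .
qed

lemma continuous_weight: "continuous_on UNIV (\<lambda>p::(nat \<Rightarrow> real) \<times> real. weight (fst p) S)"
  unfolding weight_def
proof (rule continuous_on_sum)
  fix i
  show "continuous_on UNIV (\<lambda>p::(nat \<Rightarrow> real) \<times> real. fst p i)"
    by (rule continuous_on_compose2[of UNIV "\<lambda>f. f i" UNIV fst])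
       (auto intro: continuous_on_fst continuous_on_id continuous_on_product_coordinates)
qed

lemma least_roughly_weighted_exists:
  assumes n: "n \<ge> 1" and g: "g \<in> simple_games n"
  shows "\<exists>\<alpha>\<ge>1. roughly_weighted n \<alpha> g \<and> (\<forall>\<beta>\<ge>1. roughly_weighted n \<beta> g \<longrightarrow> \<alpha> \<le> \<beta>)"
proof -
  define K :: "((nat \<Rightarrow> real) \<times> real) set"
    where "K = PiE UNIV (\<lambda>_. {0..1}) \<times> {1..real n}"
  define W where "W = (\<Inter>S\<in>{S. winning n g S}. {p::(nat \<Rightarrow> real) \<times> real. 1 \<le> weight (fst p) S})"
  define L where "L = (\<Inter>S\<in>{S. losing n g S}. {p::(nat \<Rightarrow> real) \<times> real. weight (fst p) S \<le> snd p})"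
  have "compactin (product_topology (\<lambda>_. euclidean) UNIV) (PiE (UNIV::nat set) (\<lambda>_. {0..1::real}))"
    by (subst compactin_PiE) auto
  hence "compact K"
    unfolding K_def by (intro compact_Times) (auto simp: euclidean_product_topology)
  moreover have "closed W" unfolding W_def
    by (intro closed_INT ballI closed_Collect_le continuous_weight continuous_on_const)
  moreover have "closed L" unfolding L_def
    by (intro closed_INT ballI closed_Collect_le continuous_weight continuous_on_snd continuous_on_id)
  ultimately have comp: "compact (K \<inter> W \<inter> L)"
    by (intro compact_Int_closed)
  have ones: "((\<lambda>_. 1), real n) \<in> K \<inter> W \<inter> L"
  proof -
    have "weight (\<lambda>_. 1) S \<ge> 1" if "winning n g S" for S
    proof -
      have "g {} = 0" using g by (simp add: simple_games_def)
      hence "S \<noteq> {}" "finite S" using that by (auto simp: winning_def intro: finite_subset)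
      hence "card S \<ge> 1" by (simp add: Suc_leI card_gt_0_iff)
      thus ?thesis by (simp add: weight_def)
    qed
    moreover have "weight (\<lambda>_. 1) S \<le> real n" if "losing n g S" for S
      using that card_mono[of "{1..n}" S] by (simp add: weight_def losing_def)
    ultimately show ?thesis using n by (auto simp: K_def W_def L_def)
  qed
  have "K \<inter> W \<inter> L \<noteq> {}" using ones by blast
  moreover have "continuous_on (K \<inter> W \<inter> L) snd"
    by (intro continuous_on_snd continuous_on_id)
  ultimately have "\<exists>p\<in>K \<inter> W \<inter> L. \<forall>q\<in>K \<inter> W \<inter> L. snd p \<le> snd q"
    by (rule continuous_attains_inf[OF comp])
  then obtain p where p: "p \<in> K \<inter> W \<inter> L" "\<And>q. q \<in> K \<inter> W \<inter> L \<Longrightarrow> snd p \<le> snd q"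
    by blast
  show ?thesis
  proof (intro exI[of _ "snd p"] conjI allI impI)
    show "1 \<le> snd p" using p(1) by (auto simp: K_def)
    show "roughly_weighted n (snd p) g"
      unfolding roughly_weighted_def
      using p(1) by (intro exI[of _ "fst p"]) (auto simp: W_def L_def)
  next
    fix \<beta> :: real assume \<beta>: "1 \<le> \<beta>" "roughly_weighted n \<beta> g"
    show "snd p \<le> \<beta>"
    proof (cases "\<beta> \<le> real n")
      case False
      thus ?thesis using p(2)[OF ones] by simp
    next
      case True
      obtain w where w: "\<And>S. winning n g S \<Longrightarrow> weight w S \<ge> 1"
        "\<And>S. losing n g S \<Longrightarrow> weight w S \<le> \<beta>"
        using \<beta>(2) unfolding roughly_weighted_def by blast
      define v where "v = (\<lambda>i. min 1 (max 0 (w i)))"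
      have "(v, \<beta>) \<in> K \<inter> W \<inter> L"
        using truncate_weights[OF g w] \<beta>(1) True
        by (auto simp: K_def W_def L_def v_def)
      thus ?thesis using p(2) by fastforce
    qed
  qed
qed

lemma critical_threshold_attained:
  assumes "n \<ge> 1" and "g \<in> simple_games n"
  shows "1 \<le> critical_threshold n g"
    and "roughly_weighted n (critical_threshold n g) g"
    and "\<And>\<beta>. 1 \<le> \<beta> \<Longrightarrow> roughly_weighted n \<beta> g \<Longrightarrow> critical_threshold n g \<le> \<beta>"
proof -
  obtain \<alpha> where \<alpha>: "1 \<le> \<alpha> \<and> roughly_weighted n \<alpha> g"
      "\<And>\<beta>. 1 \<le> \<beta> \<and> roughly_weighted n \<beta> g \<Longrightarrow> \<alpha> \<le> \<beta>"
    using least_roughly_weighted_exists[OF assms] by blast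
  have eq: "critical_threshold n g = \<alpha>"
    unfolding critical_threshold_def by (rule Least_equality) (fact \<alpha>)+
  show "1 \<le> critical_threshold n g" "roughly_weighted n (critical_threshold n g) g"
    using \<alpha>(1) by (auto simp: eq)
  show "\<And>\<beta>. 1 \<le> \<beta> \<Longrightarrow> roughly_weighted n \<beta> g \<Longrightarrow> critical_threshold n g \<le> \<beta>"
    using \<alpha>(2) by (auto simp: eq)
qed

end

theory Submission
  imports Defs
begin

text \<open>Let \<open>p\<close> be a vector of minimal Euclidean norm among the weights in \<open>[0,1]\<close> for which every
  winning coalition has weight at least 1. If \<open>L\<close> is losing, then by monotonicity its complement
  meets every winning coalition, so the indicator \<open>q\<close> of the complement is again feasible.
  Minimality gives \<open>p \<bullet> (q - p) \<ge> 0\<close>, that is, the weight of the complement of \<open>L\<close> is at least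
  \<open>p \<bullet> p\<close>, whence \<open>L\<close> has weight at most \<open>\<Sum>i. p i * (1 - p i) \<le> n / 4\<close>.\<close>

text \<open>The bounds range over all natural indices, not only over the voters, so that the set
  lies in a product of compact intervals.\<close>

definition feasible_weights :: "nat \<Rightarrow> (nat set \<Rightarrow> nat) \<Rightarrow> (nat \<Rightarrow> real) set" where
  "feasible_weights n g =
     {w. (\<forall>i. 0 \<le> w i \<and> w i \<le> 1) \<and> (\<forall>S. winning n g S \<longrightarrow> 1 \<le> weight w S)}"

text \<open>The box is compact by Tychonoff, and continuity of \<open>weight w S\<close> in
  \<open>w\<close> makes every winning constraint closed.\<close>

lemma compact_feasible_weights: "compact (feasible_weights n g)"
proof -
  have "compactin (product_topology (\<lambda>_. euclidean) UNIV) (PiE (UNIV::nat set) (\<lambda>_. {0..1::real}))"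
    by (subst compactin_PiE) auto
  hence box: "compact (PiE (UNIV::nat set) (\<lambda>_. {0..1::real}))"
    by (simp add: euclidean_product_topology)
  have "continuous_on UNIV (\<lambda>w::nat \<Rightarrow> real. weight w S)" for S
    unfolding weight_def
    by (intro continuous_on_sum continuous_on_product_coordinates)
  hence "closed (\<Inter>S\<in>{S. winning n g S}. {w. 1 \<le> weight w S})"
    by (intro closed_INT ballI closed_Collect_le continuous_on_const)
  moreover have "feasible_weights n g =
      PiE UNIV (\<lambda>_. {0..1}) \<inter> (\<Inter>S\<in>{S. winning n g S}. {w. 1 \<le> weight w S})"
    by (auto simp: feasible_weights_def PiE_iff)
  ultimately show ?thesis
    using box by (simp add: compact_Int_closed)
qed

lemma feasible_weights_convex_combination:
  assumes p: "p \<in> feasible_weights n g" and q: "q \<in> feasible_weights n g"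
    and t: "0 \<le> t" "t \<le> 1"
  shows "(\<lambda>i. p i + t * (q i - p i)) \<in> feasible_weights n g"
proof -
  have eq: "p i + t * (q i - p i) = (1 - t) * p i + t * q i" for i
    by (simp add: algebra_simps)
  have "0 \<le> p i + t * (q i - p i)" "p i + t * (q i - p i) \<le> 1" for i
    unfolding eq using p q t
    by (auto simp: feasible_weights_def intro: convex_bound_le)
  moreover have "1 \<le> weight (\<lambda>i. p i + t * (q i - p i)) S" if "winning n g S" for S
  proof -
    have "weight (\<lambda>i. p i + t * (q i - p i)) S = (1 - t) * weight p S + t * weight q S"
      unfolding eq weight_def by (simp add: sum.distrib sum_distrib_left)
    moreover have "(1 - t) * 1 + t * 1 \<le> (1 - t) * weight p S + t * weight q S"
      using p q t that by (intro add_mono mult_left_mono) (auto simp: feasible_weights_def)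
    ultimately show ?thesis by simp
  qed
  ultimately show ?thesis by (auto simp: feasible_weights_def)
qed

lemma complement_of_losing_feasible:
  assumes g: "g \<in> simple_games n" and L: "losing n g L"
  shows "indicator (- L) \<in> feasible_weights n g"
proof -
  have "1 \<le> weight (indicator (- L)) S" if S: "winning n g S" for S
  proof -
    have fin: "finite S" using S by (auto simp: winning_def intro: finite_subset)
    have "\<not> S \<subseteq> L"
    proof
      assume "S \<subseteq> L"
      hence "g S \<le> g L" using g L unfolding simple_games_def losing_def by blast
      thus False using S L by (simp add: winning_def losing_def)
    qed
    then obtain i where i: "i \<in> S" "i \<notin> L" by blast
    have "indicator (- L) i \<le> weight (indicator (- L)) S"
      unfolding weight_def by (rule member_le_sum) (use i fin in auto)
    thus ?thesis using i by simp
  qed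
  thus ?thesis by (auto simp: feasible_weights_def indicator_def)
qed

text \<open>Dividing by \<open>t\<close> and letting \<open>t\<close> tend to 0 leaves the linear
  coefficient \<open>2 * D\<close>.\<close>

lemma nonneg_if_small_perturbations_nonneg:
  fixes D E :: real
  assumes E: "0 \<le> E" and pert: "\<And>t. 0 < t \<Longrightarrow> t \<le> 1 \<Longrightarrow> 0 \<le> 2 * t * D + t\<^sup>2 * E"
  shows "0 \<le> D"
proof (rule ccontr)
  assume "\<not> 0 \<le> D"
  hence D: "D < 0" by simp
  \<comment> \<open>With this \<open>t\<close> the quadratic term satisfies
    \<open>t * E \<le> - D\<close>, too little to offset \<open>2 * D\<close>; the
    \<open>+ 1\<close> keeps the denominator positive when \<open>E = 0\<close>.\<close>
  define t where "t = min 1 (- D / (E + 1))"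
  have t: "0 < t" "t \<le> 1" "t \<le> - D / (E + 1)" using D E by (auto simp: t_def intro: divide_neg_pos)
  have "t * E \<le> t * (E + 1)" using t by simp
  also have "\<dots> \<le> - D" using t(3) E by (simp add: field_simps)
  finally have "2 * D + t * E < 0" using D by simp
  hence "t * (2 * D + t * E) < 0" using t(1) by (simp add: mult_pos_neg)
  thus False using pert[OF t(1,2)] by (simp add: algebra_simps power2_eq_square)
qed

text \<open>First-order optimality on a convex set: the segment from \<open>p\<close> to
  \<open>q\<close> stays feasible, so the squared norm cannot decrease along it, and its derivative
  at \<open>p\<close> is twice the sum below.\<close>

lemma minimal_norm_variational_inequality:
  assumes p: "p \<in> feasible_weights n g" and q: "q \<in> feasible_weights n g"
    and min: "\<And>w. w \<in> feasible_weights n g \<Longrightarrow> (\<Sum>i\<in>{1..n}. (p i)\<^sup>2) \<le> (\<Sum>i\<in>{1..n}. (w i)\<^sup>2)"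
  shows "0 \<le> (\<Sum>i\<in>{1..n}. p i * (q i - p i))"
proof (rule nonneg_if_small_perturbations_nonneg)
  show "0 \<le> (\<Sum>i\<in>{1..n}. (q i - p i)\<^sup>2)" by (simp add: sum_nonneg)
next
  fix t :: real assume t: "0 < t" "t \<le> 1"
  have "(\<Sum>i\<in>{1..n}. (p i)\<^sup>2) \<le> (\<Sum>i\<in>{1..n}. (p i + t * (q i - p i))\<^sup>2)"
    by (rule min, rule feasible_weights_convex_combination) (use p q t in auto)
  also have "\<dots> = (\<Sum>i\<in>{1..n}. (p i)\<^sup>2 + (2 * t * (p i * (q i - p i)) + t\<^sup>2 * (q i - p i)\<^sup>2))"
    by (rule sum.cong) (auto simp: power2_eq_square algebra_simps)
  also have "\<dots> = (\<Sum>i\<in>{1..n}. (p i)\<^sup>2) +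
      (2 * t * (\<Sum>i\<in>{1..n}. p i * (q i - p i)) + t\<^sup>2 * (\<Sum>i\<in>{1..n}. (q i - p i)\<^sup>2))"
    by (simp only: sum.distrib sum_distrib_left)
  finally show "0 \<le> 2 * t * (\<Sum>i\<in>{1..n}. p i * (q i - p i)) + t\<^sup>2 * (\<Sum>i\<in>{1..n}. (q i - p i)\<^sup>2)"
    by simp
qed

lemma roughly_weighted_quarter:
  assumes g: "g \<in> simple_games n"
  shows "roughly_weighted n (real n / 4) g"
proof -
  \<comment> \<open>The complement of the empty coalition gives the all-ones weights as a feasible
    point.\<close>
  have "losing n g {}" using g by (simp add: simple_games_def losing_def)
  hence "feasible_weights n g \<noteq> {}" using complement_of_losing_feasible[OF g] by blast
  moreover have "continuous_on (feasible_weights n g) (\<lambda>w. \<Sum>i\<in>{1..n}. (w i)\<^sup>2)"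
    by (intro continuous_on_sum continuous_on_power
        continuous_on_product_coordinates[THEN continuous_on_subset]) auto
  ultimately obtain p where p: "p \<in> feasible_weights n g"
    and min: "\<And>w. w \<in> feasible_weights n g \<Longrightarrow> (\<Sum>i\<in>{1..n}. (p i)\<^sup>2) \<le> (\<Sum>i\<in>{1..n}. (w i)\<^sup>2)"
    using continuous_attains_inf[OF compact_feasible_weights] by blast
  have "weight p L \<le> real n / 4" if L: "losing n g L" for L
  proof -
    have sub: "L \<subseteq> {1..n}" using L by (simp add: losing_def)
    have "0 \<le> (\<Sum>i\<in>{1..n}. p i * (indicator (- L) i - p i))"
      by (rule minimal_norm_variational_inequality[OF p complement_of_losing_feasible[OF g L] min])
    moreover have "weight p L = (\<Sum>i\<in>{1..n}. p i * indicator L i)"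
      unfolding weight_def
      by (rule sum.mono_neutral_cong_left) (use sub in \<open>auto simp: indicator_def\<close>)
    \<comment> \<open>After adding the two sums, voter \<open>i\<close> contributes
      \<open>p i * (1 - p i)\<close> whether \<open>i\<close> lies in \<open>L\<close> or not:
      \<open>p i - p i * p i\<close> inside, \<open>0 + p i * (1 - p i)\<close> outside. The bound
      thus no longer depends on \<open>L\<close>.\<close>
    ultimately have "weight p L \<le> (\<Sum>i\<in>{1..n}. p i * indicator L i)
        + (\<Sum>i\<in>{1..n}. p i * (indicator (- L) i - p i))"
      by simp
    also have "\<dots> = (\<Sum>i\<in>{1..n}. p i * (1 - p i))"
      unfolding sum.distrib[symmetric]
      by (rule sum.cong) (auto simp: indicator_def algebra_simps)
    also have "\<dots> \<le> (\<Sum>i\<in>{1..n}. 1 / 4)"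
    proof (rule sum_mono)
      fix i
      have "0 \<le> (p i - 1 / 2)\<^sup>2" by simp
      thus "p i * (1 - p i) \<le> 1 / 4" by (simp add: power2_eq_square algebra_simps)
    qed
    finally show ?thesis by simp
  qed
  thus ?thesis
    using p by (auto simp: roughly_weighted_def feasible_weights_def)
qed

lemma roughly_weighted_mono:
  assumes "roughly_weighted n \<alpha> g" and "\<alpha> \<le> \<beta>"
  shows "roughly_weighted n \<beta> g"
  using assms unfolding roughly_weighted_def by (meson order_trans)

theorem corollary1:
  fixes n :: nat
  assumes "n \<ge> 3"
  shows "c_S n \<le> real n / 3"
proof -
  have n: "n \<ge> 1" using assms by simp
  have "critical_threshold n g \<le> real n / 3" if g: "g \<in> simple_games n" for g
  proof (rule critical_threshold_attained(3)[OF n g])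
    \<comment> \<open>The threshold is a minimum over values at least 1. Since \<open>n / 4\<close>
      is below 1 for \<open>n = 3\<close>, the quarter bound is first weakened to
      \<open>n / 3\<close>.\<close>
    show "1 \<le> real n / 3" using assms by simp
    show "roughly_weighted n (real n / 3) g"
      by (rule roughly_weighted_mono[OF roughly_weighted_quarter[OF g]]) simp
  qed
  thus ?thesis
    unfolding c_S_def using finite_simple_games[of n] simple_games_nonempty[OF n]
    by (subst Max_le_iff) auto
qed

end
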